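(* Let $X$ be a topological space. The following are equivalent: (1) $X$ is discrete. (2) Every subset of $X$ is an $\mathcal{AB}$-set. (3) Every singleton of $X$ is an $\mathcal{AB}$-set.
   Context: For a subset $A$ of a topological space $X$, $\mathrm{Int}\,A$ denotes the interior and $\overline{A}$ the closure of $A$ in $X$. $A$ is semi-open if $A \subseteq \overline{\mathrm{Int}\,A}$; semi-closed if its complement is semi-open; semi-regular if it is both semi-open and semi-closed. $A$ is an $\mathcal{AB}$-set if $A = U \cap V$ with $U$ open and $V$ semi-regular. No separation axioms are assumed. *)

theory Defs
  imports "HOL-Analysis.Abstract_Topology"
begin

definition semi_open :: "'a topology \<Rightarrow> 'a set \<Rightarrow> bool" where
  "semi_open X A \<longleftrightarrow> A \<subseteq> topspace X \<and> A \<subseteq> X closure_of (X interior_of A)"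

definition semi_closed :: "'a topology \<Rightarrow> 'a set \<Rightarrow> bool" where
  "semi_closed X A \<longleftrightarrow> A \<subseteq> topspace X \<and> semi_open X (topspace X - A)"

definition semi_regular :: "'a topology \<Rightarrow> 'a set \<Rightarrow> bool" where
  "semi_regular X A \<longleftrightarrow> semi_open X A \<and> semi_closed X A"

definition AB_set :: "'a topology \<Rightarrow> 'a set \<Rightarrow> bool" where
  "AB_set X A \<longleftrightarrow> (\<exists>U V. openin X U \<and> semi_regular X V \<and> A = U \<inter> V)"

end

theory Submission
  imports Defs
begin

lemma semi_regular_topspace: "semi_regular X (topspace X)"
  by (simp add: semi_regular_def semi_closed_def semi_open_def)

text \<open>The whole space is semi-regular, so it can serve as the second factor next to the open
  set itself. In a discrete space this covers every subset.\<close>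

lemma openin_imp_AB_set:
  assumes "openin X A"
  shows "AB_set X A"
  unfolding AB_set_def
proof (intro exI conjI)
  show "A = A \<inter> topspace X"
    using openin_subset[OF assms] by blast
qed (use assms semi_regular_topspace in auto)

text \<open>If \<open>{x} = U \<inter> V\<close>, the neighbourhood \<open>U\<close> of \<open>x\<close> meets the interior of \<open>V\<close> because \<open>V\<close> is
  semi-open, and it can do so only in \<open>x\<close>.\<close>

lemma AB_set_singleton_imp_openin:
  assumes "AB_set X {x}"
  shows "openin X {x}"
proof -
  obtain U V where U: "openin X U" and V: "V \<subseteq> X closure_of (X interior_of V)"
    and eq: "{x} = U \<inter> V"
    using assms unfolding AB_set_def semi_regular_def semi_open_def by blast
  have "x \<in> X closure_of (X interior_of V)" "x \<in> U"
    using V eq by auto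
  then obtain y where "y \<in> U \<inter> X interior_of V"
    using U by (auto simp: in_closure_of)
  moreover have "U \<inter> X interior_of V \<subseteq> {x}"
    using interior_of_subset[of X V] eq by blast
  ultimately have "U \<inter> X interior_of V = {x}"
    by blast
  \<comment> \<open>Both \<open>U\<close> and \<open>X interior_of V\<close> are open, hence so is
    their intersection.\<close>
  then show ?thesis
    using openin_Int[OF U openin_interior_of[of X V]] by simp
qed

theorem theorem3p5:
  fixes X :: "'a topology"
  shows "(X = discrete_topology (topspace X) \<longleftrightarrow> (\<forall>A. A \<subseteq> topspace X \<longrightarrow> AB_set X A)) \<and>
         ((\<forall>A. A \<subseteq> topspace X \<longrightarrow> AB_set X A) \<longleftrightarrow> (\<forall>x\<in>topspace X. AB_set X {x}))"
proof -
  \<comment> \<open>Three implications closing a cycle give both equivalences.\<close>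
  have "AB_set X A" if "X = discrete_topology (topspace X)" "A \<subseteq> topspace X" for A
    using that by (metis openin_discrete_topology openin_imp_AB_set)
  \<comment> \<open>A topology is discrete once its singletons are open, since every subset is a
    union of singletons.\<close>
  moreover have "X = discrete_topology (topspace X)" if "\<forall>x\<in>topspace X. AB_set X {x}"
    using that AB_set_singleton_imp_openin by (metis discrete_topology_unique)
  moreover have "\<forall>x\<in>topspace X. AB_set X {x}" if "\<forall>A. A \<subseteq> topspace X \<longrightarrow> AB_set X A"
    using that by simp
  ultimately show ?thesis
    by blast
qed

end
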